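(* Let $A$ and $B$ be arbitrary semigroups, and let $P:B\to A$ be a mapping such that $\alpha_P$ is a congruence on $A$. Define $P':B\to A/\alpha_P$ by $P'(b)=[P(b)]_{\alpha_P}$ for every $b\in B$. Then the triple $A, B, A/\alpha_P$ is right regular with respect to $(P,P')$.
   Context: A semigroup is a nonempty set with an associative multiplication; mappings are not assumed to be homomorphisms. For a semigroup $S$, a nonempty set $\Lambda$ and a mapping $P:\Lambda\to S$, let $\mathcal{M}(S;\Lambda;P)$ denote the semigroup on the set $S\times\Lambda$ with multiplication $(s,\lambda)(t,\mu)=(sP(\lambda)t,\mu)$. For a semigroup $S$, $\theta_S=\{(a,b)\in S\times S: xa=xb \text{ for all } x\in S\}$; this is a congruence on $S$. For semigroups $A,B,C$ and mappings $P:B\to A$, $P':B\to C$, the triple $A,B,C$ is right regular with respect to $(P,P')$ if $\mathcal{M}(A;B;P)/\theta_{\mathcal{M}(A;B;P)}\cong\mathcal{M}(C;B;P')$ as semigroups. For a semigroup $A$, a nonempty set $B$ and a mapping $P:B\to A$, $\alpha_P=\{(a_1,a_2)\in A\times A: aP(b)a_1=aP(b)a_2 \text{ for all } a\in A,\ b\in B\}$, which is a right congruence on $A$. $[a]_{\alpha}$ denotes the $\alpha$-class of $a$. *)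

theory Defs
  imports "HOL-Algebra.Congruence" "HOL-Library.FuncSet"
begin

(* The monoid record of HOL-Algebra carries a unit, which a semigroup need not have. *)
record 'a magma = "'a partial_object" +
  mult :: "'a \<Rightarrow> 'a \<Rightarrow> 'a"  (infixl "\<otimes>\<index>" 70)

locale sgroup =
  fixes S :: "'a magma" (structure)
  assumes nonempty: "carrier S \<noteq> {}"
    and closed: "a \<in> carrier S \<Longrightarrow> b \<in> carrier S \<Longrightarrow> a \<otimes> b \<in> carrier S"
    and assoc: "a \<in> carrier S \<Longrightarrow> b \<in> carrier S \<Longrightarrow> c \<in> carrier S \<Longrightarrow>
                  (a \<otimes> b) \<otimes> c = a \<otimes> (b \<otimes> c)"

definition sgroup_iso :: "'a magma \<Rightarrow> 'b magma \<Rightarrow> ('a \<Rightarrow> 'b) set" where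
  "sgroup_iso S T =
     {h. bij_betw h (carrier S) (carrier T) \<and>
         (\<forall>a \<in> carrier S. \<forall>b \<in> carrier S. h (a \<otimes>\<^bsub>S\<^esub> b) = h a \<otimes>\<^bsub>T\<^esub> h b)}"

definition sgroup_isomorphic :: "'a magma \<Rightarrow> 'b magma \<Rightarrow> bool" where
  "sgroup_isomorphic S T \<longleftrightarrow> sgroup_iso S T \<noteq> {}"

definition sgroup_congruence :: "'a magma \<Rightarrow> ('a \<times> 'a) set \<Rightarrow> bool" where
  "sgroup_congruence S r \<longleftrightarrow>
     equiv (carrier S) r \<and>
     (\<forall>a b c. (a, b) \<in> r \<longrightarrow> c \<in> carrier S \<longrightarrow>
        (c \<otimes>\<^bsub>S\<^esub> a, c \<otimes>\<^bsub>S\<^esub> b) \<in> r \<and> (a \<otimes>\<^bsub>S\<^esub> c, b \<otimes>\<^bsub>S\<^esub> c) \<in> r)"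

(* If r is a congruence, the union in the product ranges over copies of one and the same class;
   see quotient_mult_class below. *)
definition quotient_sgroup :: "'a magma \<Rightarrow> ('a \<times> 'a) set \<Rightarrow> 'a set magma" where
  "quotient_sgroup S r =
     \<lparr>carrier = carrier S // r,
      mult = (\<lambda>X Y. \<Union>a \<in> X. \<Union>b \<in> Y. r `` {a \<otimes>\<^bsub>S\<^esub> b})\<rparr>"

definition theta :: "'a magma \<Rightarrow> ('a \<times> 'a) set" where
  "theta S = {(a, b) \<in> carrier S \<times> carrier S. \<forall>x \<in> carrier S. x \<otimes>\<^bsub>S\<^esub> a = x \<otimes>\<^bsub>S\<^esub> b}"

definition matrix_sgroup :: "'a magma \<Rightarrow> 'l set \<Rightarrow> ('l \<Rightarrow> 'a) \<Rightarrow> ('a \<times> 'l) magma" where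
  "matrix_sgroup S L P =
     \<lparr>carrier = carrier S \<times> L,
      mult = (\<lambda>(s, l) (t, m). (s \<otimes>\<^bsub>S\<^esub> P l \<otimes>\<^bsub>S\<^esub> t, m))\<rparr>"

definition alpha :: "'a magma \<Rightarrow> 'b set \<Rightarrow> ('b \<Rightarrow> 'a) \<Rightarrow> ('a \<times> 'a) set" where
  "alpha A B P =
     {(a1, a2) \<in> carrier A \<times> carrier A.
        \<forall>a \<in> carrier A. \<forall>b \<in> B. a \<otimes>\<^bsub>A\<^esub> P b \<otimes>\<^bsub>A\<^esub> a1 = a \<otimes>\<^bsub>A\<^esub> P b \<otimes>\<^bsub>A\<^esub> a2}"

definition right_regular ::
    "'a magma \<Rightarrow> 'b magma \<Rightarrow> 'c magma \<Rightarrow> ('b \<Rightarrow> 'a) \<Rightarrow> ('b \<Rightarrow> 'c) \<Rightarrow> bool" where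
  "right_regular A B C P P' \<longleftrightarrow>
     sgroup A \<and> sgroup B \<and> sgroup C \<and>
     P \<in> carrier B \<rightarrow> carrier A \<and> P' \<in> carrier B \<rightarrow> carrier C \<and>
     sgroup_isomorphic
       (quotient_sgroup (matrix_sgroup A (carrier B) P) (theta (matrix_sgroup A (carrier B) P)))
       (matrix_sgroup C (carrier B) P')"

lemma (in sgroup) quotient_mult_class:
  assumes r: "sgroup_congruence S r" and a: "a \<in> carrier S" and b: "b \<in> carrier S"
  shows "r `` {a} \<otimes>\<^bsub>quotient_sgroup S r\<^esub> r `` {b} = r `` {a \<otimes> b}"
proof -
  have eq: "equiv (carrier S) r"
    using r by (simp add: sgroup_congruence_def)
  have cls: "r `` {x \<otimes> y} = r `` {a \<otimes> b}" if x: "(a, x) \<in> r" and y: "(b, y) \<in> r" for x y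
  proof -
    have "x \<in> carrier S"
      using equiv_class_eq_iff[OF eq] x by blast
    then have "(a \<otimes> b, x \<otimes> b) \<in> r" "(x \<otimes> b, x \<otimes> y) \<in> r"
      using r x y b by (auto simp: sgroup_congruence_def)
    then show ?thesis
      using equiv_class_eq[OF eq] by metis
  qed
  have "a \<in> r `` {a}" "b \<in> r `` {b}"
    using equiv_class_self[OF eq] a b by auto
  then have "(\<Union>x \<in> r `` {a}. \<Union>y \<in> r `` {b}. r `` {x \<otimes> y}) = r `` {a \<otimes> b}"
    using cls by blast
  then show ?thesis
    by (simp add: quotient_sgroup_def)
qed

lemma (in sgroup) sgroup_matrix_sgroup:
  assumes "L \<noteq> {}" and "P \<in> L \<rightarrow> carrier S"
  shows "sgroup (matrix_sgroup S L P)"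
  using assms nonempty
  by unfold_locales (auto simp: matrix_sgroup_def closed assoc Pi_iff)

lemma (in sgroup) theta_congruence: "sgroup_congruence S (theta S)"
  unfolding sgroup_congruence_def
proof (intro conjI allI impI)
  show "equiv (carrier S) (theta S)"
    by (rule equivI) (auto simp: theta_def refl_on_def sym_on_def trans_on_def)
next
  fix a b c assume ab: "(a, b) \<in> theta S" and c: "c \<in> carrier S"
  have a: "a \<in> carrier S" and b: "b \<in> carrier S"
    and eq: "x \<in> carrier S \<Longrightarrow> x \<otimes> a = x \<otimes> b" for x
    using ab unfolding theta_def by blast+
  have "x \<otimes> (c \<otimes> a) = x \<otimes> (c \<otimes> b)" if x: "x \<in> carrier S" for x
    by (simp only: assoc[OF x c a, symmetric] assoc[OF x c b, symmetric] eq[OF closed[OF x c]])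
  then show "(c \<otimes> a, c \<otimes> b) \<in> theta S"
    unfolding theta_def using closed a b c by blast
  have "x \<otimes> (a \<otimes> c) = x \<otimes> (b \<otimes> c)" if x: "x \<in> carrier S" for x
    by (simp only: assoc[OF x a c, symmetric] assoc[OF x b c, symmetric] eq[OF x])
  then show "(a \<otimes> c, b \<otimes> c) \<in> theta S"
    unfolding theta_def using closed a b c by blast
qed

end

theory Submission imports Defs begin

text \<open>Let \<open>M\<close> be the matrix semigroup of \<open>A\<close> over \<open>B\<close>
  with sandwich map \<open>P\<close>. Sending (s, l) to ([s], l), with classes modulo
  \<open>alpha\<close>, maps \<open>M\<close> onto the matrix semigroup of the quotient with
  sandwich map \<open>P'\<close>. It is a homomorphism because \<open>alpha\<close> is a congruence
  and \<open>P'\<close> l is the class of \<open>P\<close> l. Its kernel is \<open>theta M\<close>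
  (\<open>theta_matrix_sgroup_iff\<close>): a product (x, n)(s, l) = (x P(n) s, l) keeps l and sees
  s only through x P(n) s, which is what \<open>alpha\<close> compares. The homomorphism theorem
  \<open>quotient_isomorphic_image\<close> then gives the isomorphism.\<close>

lemma quotient_sgroupE:
  assumes "X \<in> carrier (quotient_sgroup S r)"
  obtains a where "a \<in> carrier S" and "X = r `` {a}"
  using assms by (auto simp: quotient_sgroup_def elim: quotientE)

lemma class_in_quotient_sgroup:
  "a \<in> carrier S \<Longrightarrow> r `` {a} \<in> carrier (quotient_sgroup S r)"
  by (simp add: quotient_sgroup_def quotientI)

text \<open>\<open>right_regular\<close> also asks that its third component be a semigroup. Closure
  and associativity pass from representatives to classes.\<close>

lemma (in sgroup) sgroup_quotient_sgroup:
  assumes r: "sgroup_congruence S r"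
  shows "sgroup (quotient_sgroup S r)"
proof
  show "carrier (quotient_sgroup S r) \<noteq> {}"
    using nonempty class_in_quotient_sgroup[of _ S r] by fastforce
next
  fix X Y assume "X \<in> carrier (quotient_sgroup S r)" "Y \<in> carrier (quotient_sgroup S r)"
  then show "X \<otimes>\<^bsub>quotient_sgroup S r\<^esub> Y \<in> carrier (quotient_sgroup S r)"
    by (elim quotient_sgroupE)
       (simp add: quotient_mult_class[OF r] class_in_quotient_sgroup closed)
next
  fix X Y Z assume "X \<in> carrier (quotient_sgroup S r)" "Y \<in> carrier (quotient_sgroup S r)"
    "Z \<in> carrier (quotient_sgroup S r)"
  then show "X \<otimes>\<^bsub>quotient_sgroup S r\<^esub> Y \<otimes>\<^bsub>quotient_sgroup S r\<^esub> Z =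
      X \<otimes>\<^bsub>quotient_sgroup S r\<^esub> (Y \<otimes>\<^bsub>quotient_sgroup S r\<^esub> Z)"
    by (elim quotient_sgroupE) (simp add: quotient_mult_class[OF r] closed assoc)
qed

text \<open>The homomorphism theorem: a surjective homomorphism factors through its kernel, and the
  induced map on classes is bijective.\<close>

lemma (in sgroup) quotient_isomorphic_image:
  assumes r: "sgroup_congruence S r"
    and hom: "\<And>a b. a \<in> carrier S \<Longrightarrow> b \<in> carrier S \<Longrightarrow> f (a \<otimes> b) = f a \<otimes>\<^bsub>T\<^esub> f b"
    and surj: "f ` carrier S = carrier T"
    and ker: "\<And>a b. a \<in> carrier S \<Longrightarrow> b \<in> carrier S \<Longrightarrow> (a, b) \<in> r \<longleftrightarrow> f a = f b"
  shows "sgroup_isomorphic (quotient_sgroup S r) T"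
proof -
  have eq: "equiv (carrier S) r"
    using r by (simp add: sgroup_congruence_def)
  \<comment> \<open>\<open>f\<close> is constant on each class, so the image of a class is a
    singleton and \<open>the_elem\<close> extracts the common value.\<close>
  define h where "h X = the_elem (f ` X)" for X
  have h: "h (r `` {a}) = f a" if a: "a \<in> carrier S" for a
  proof -
    have "f b = f a" if "(a, b) \<in> r" for b
      using that ker[OF a, of b] equiv_class_eq_iff[OF eq] by fastforce
    then have "f ` (r `` {a}) = {f a}"
      using equiv_class_self[OF eq a] by blast
    then show ?thesis
      by (simp add: h_def)
  qed
  have "inj_on h (carrier (quotient_sgroup S r))"
    by (intro inj_onI, elim quotient_sgroupE)
       (simp add: h ker[symmetric] eq_equiv_class_iff[OF eq])
  \<comment> \<open>With every class written as the class of a representative, surjectivity of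
    \<open>h\<close> reduces to that of \<open>f\<close>.\<close>
  moreover have "carrier (quotient_sgroup S r) = (\<lambda>a. r `` {a}) ` carrier S"
    by (auto simp: class_in_quotient_sgroup elim: quotient_sgroupE)
  then have "h ` carrier (quotient_sgroup S r) = carrier T"
    by (simp add: image_image h surj)
  moreover have "h (X \<otimes>\<^bsub>quotient_sgroup S r\<^esub> Y) = h X \<otimes>\<^bsub>T\<^esub> h Y"
    if "X \<in> carrier (quotient_sgroup S r)" "Y \<in> carrier (quotient_sgroup S r)" for X Y
    using that by (elim quotient_sgroupE) (simp add: quotient_mult_class[OF r] h closed hom)
  ultimately have "h \<in> sgroup_iso (quotient_sgroup S r) T"
    by (simp add: sgroup_iso_def bij_betw_def)
  then show ?thesis
    unfolding sgroup_isomorphic_def by blast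
qed

lemma carrier_matrix_sgroup: "carrier (matrix_sgroup S L P) = carrier S \<times> L"
  by (simp add: matrix_sgroup_def)

text \<open>Nonemptiness supplies a left factor (x, n); comparing second components of the products
  gives \<open>l = m\<close>. The first components, over all x and n, give the condition defining
  \<open>alpha\<close>.\<close>

lemma theta_matrix_sgroup_iff:
  assumes "carrier A \<noteq> {}" and "L \<noteq> {}"
  shows "((s, l), (t, m)) \<in> theta (matrix_sgroup A L P) \<longleftrightarrow>
           (s, t) \<in> alpha A L P \<and> l \<in> L \<and> l = m"
  using assms by (auto simp: theta_def alpha_def matrix_sgroup_def)

theorem theorem7:
  fixes A :: "'a magma" and B :: "'b magma"
    and P :: "'b \<Rightarrow> 'a" and P' :: "'b \<Rightarrow> 'a set"
  assumes "sgroup A" and "sgroup B"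
    and "P \<in> carrier B \<rightarrow> carrier A"
    and "sgroup_congruence A (alpha A (carrier B) P)"
    and "\<And>b. b \<in> carrier B \<Longrightarrow> P' b = alpha A (carrier B) P `` {P b}"
  shows "right_regular A B (quotient_sgroup A (alpha A (carrier B) P)) P P'"
proof -
  interpret A: sgroup A by fact
  interpret B: sgroup B by fact
  define r where "r = alpha A (carrier B) P"
  define M where "M = matrix_sgroup A (carrier B) P"
  define f where "f = (\<lambda>(s, l :: 'b). (r `` {s}, l))"
  note P = funcset_mem[OF assms(3)]
  have r: "sgroup_congruence A r" and P': "\<And>b. b \<in> carrier B \<Longrightarrow> P' b = r `` {P b}"
    using assms(4,5) by (simp_all add: r_def)
  have eq: "equiv (carrier A) r"
    using r by (simp add: sgroup_congruence_def)
  interpret M: sgroup M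
    unfolding M_def using B.nonempty assms(3) by (rule A.sgroup_matrix_sgroup)
  have "sgroup_isomorphic (quotient_sgroup M (theta M))
          (matrix_sgroup (quotient_sgroup A r) (carrier B) P')"
  proof (rule M.quotient_isomorphic_image[OF M.theta_congruence])
    \<comment> \<open>Two uses of \<open>quotient_mult_class\<close> collapse [s][P l][t] to the
      class of s P(l) t.\<close>
    fix a b assume "a \<in> carrier M" "b \<in> carrier M"
    then show "f (a \<otimes>\<^bsub>M\<^esub> b) =
        f a \<otimes>\<^bsub>matrix_sgroup (quotient_sgroup A r) (carrier B) P'\<^esub> f b"
      by (auto simp: f_def M_def matrix_sgroup_def P P' A.closed A.quotient_mult_class[OF r])
  next
    show "f ` carrier M = carrier (matrix_sgroup (quotient_sgroup A r) (carrier B) P')"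
      by (force simp: f_def M_def matrix_sgroup_def class_in_quotient_sgroup
          elim: quotient_sgroupE)
  next
    \<comment> \<open>Both sides say that the first components are related by \<open>r\<close> and
      the second components agree.\<close>
    fix a b assume "a \<in> carrier M" "b \<in> carrier M"
    then show "(a, b) \<in> theta M \<longleftrightarrow> f a = f b"
      by (cases a, cases b)
         (auto simp: M_def theta_matrix_sgroup_iff[OF A.nonempty B.nonempty] f_def
           carrier_matrix_sgroup eq_equiv_class_iff[OF eq] simp flip: r_def)
  qed
  moreover have "P' \<in> carrier B \<rightarrow> carrier (quotient_sgroup A r)"
    by (simp add: P' P class_in_quotient_sgroup)
  ultimately show ?thesis
    using assms(1-3) A.sgroup_quotient_sgroup[OF r]
    by (simp add: right_regular_def M_def r_def)
qed

end
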